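(* Let $(F,G)\in\mathcal H_{\mathbf d}[q\,;\,s]$ with $q\leq n+1$ be a homogeneous semialgebraic system, $S=S(F,G)\subseteq\mathbb S^n$, and $D=\max_i d_i$. If $\kappa_*(F,G)<\infty$, then $D^{3/2}\,\tau(S)\,\kappa_*(F,G)\geqslant\frac17$.
   Context: $S(F,G)$ is the set of $x\in\mathbb S^n\subset\mathbb R^{n+1}$ with $f_1(x)=\dots=f_q(x)=0$ and $g_1(x)\geq0,\dots,g_s(x)\geq0$. Reach: for nonempty closed $A\subseteq\mathbb R^{n+1}$, $d_A(x)=\inf_{a\in A}\|x-a\|$ ($d_\varnothing=+\infty$), the medial axis is the closure of $\Delta_A=\{x:\exists a\neq b\in A,\ \|x-a\|=\|x-b\|=d_A(x)\}$, $\tau(A)=\inf_{p\in A}d_{\Delta_A}(p)$, and $\tau(\varnothing)=+\infty$. $\mathcal H_{\mathbf d}[q]$: $q$-tuples of real homogeneous polynomials in $X_0,\dots,X_n$ of degrees $d_i$ with the Weyl inner product ($\langle h,h'\rangle=\sum_{|a|=d}\binom da^{-1}h_ah'_a$, summed over components); $\mathcal H_{\mathbf d}[q\,;\,s]$ pairs $(F,G)$ of a $q$-tuple and an $s$-tuple. For $x\in\mathbb S^n$: $T_x=\{x\}^\perp$, $\Delta=\mathrm{diag}(\sqrt{d_i})$, $\mu_{\mathrm{proj}}(F,x)=\|F\|\,\|(\mathrm DF(x)|_{T_x})^\dagger\Delta\|$ if $\mathrm DF(x)|_{T_x}$ surjective, else $\infty$; $\kappa(F,x)=(\mu_{\mathrm{proj}}(F,x)^{-2}+\|F(x)\|^2/\|F\|^2)^{-1/2}$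 ($\infty^{-1}=0$, $0^{-1}=\infty$, $\kappa(0,x)=\infty$); $\kappa(F)=\max_x\kappa(F,x)$. $F^L$ is $F$ with the polynomials of a subtuple $L\subseteq G$ appended; $\kappa_*(F,G)=\max\{\kappa(F^L):L\subseteq G,\ q+|L|\leq n+1\}$. *)

theory Defs
  imports "HOL-Analysis.Analysis" "HOL-Library.Sublist"
begin

text \<open>Ambient space R^(n+1) is the type real^'n with CARD('n) = n+1.
  A monomial exponent is a function 'n => nat. A homogeneous polynomial is
  a pair (degree d, coefficient function); well-formedness says the coefficients
  vanish outside the monomials of total degree d.\<close>

type_synonym 'n hpoly = "nat \<times> (('n \<Rightarrow> nat) \<Rightarrow> real)"

definition monoms :: "nat \<Rightarrow> ('n::finite \<Rightarrow> nat) set" where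
  "monoms d = {a. sum a UNIV = d}"

definition hpoly_wf :: "('n::finite) hpoly \<Rightarrow> bool" where
  "hpoly_wf p \<longleftrightarrow> (\<forall>a. snd p a \<noteq> 0 \<longrightarrow> a \<in> monoms (fst p))"

definition peval :: "('n::finite) hpoly \<Rightarrow> real^'n \<Rightarrow> real" where
  "peval p x = (\<Sum>a\<in>monoms (fst p). snd p a * (\<Prod>i\<in>UNIV. (x $ i) ^ (a i)))"

definition multinom :: "nat \<Rightarrow> ('n::finite \<Rightarrow> nat) \<Rightarrow> real" where
  "multinom d a = fact d / (\<Prod>i\<in>UNIV. fact (a i))"

definition weyl_sq :: "('n::finite) hpoly \<Rightarrow> real" where
  "weyl_sq p = (\<Sum>a\<in>monoms (fst p). (snd p a)^2 / multinom (fst p) a)"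

definition tnorm :: "('n::finite) hpoly list \<Rightarrow> real" where
  "tnorm F = sqrt (\<Sum>p\<leftarrow>F. weyl_sq p)"

definition vecs :: "nat \<Rightarrow> (nat \<Rightarrow> real) set" where
  "vecs k = {w. \<forall>i\<ge>k. w i = 0}"

definition vnorm :: "nat \<Rightarrow> (nat \<Rightarrow> real) \<Rightarrow> real" where
  "vnorm k w = sqrt (\<Sum>i<k. (w i)^2)"

definition teval :: "('n::finite) hpoly list \<Rightarrow> real^'n \<Rightarrow> nat \<Rightarrow> real" where
  "teval F x = (\<lambda>i. if i < length F then peval (F ! i) x else 0)"

definition tderiv :: "('n::finite) hpoly list \<Rightarrow> real^'n \<Rightarrow> real^'n \<Rightarrow> nat \<Rightarrow> real" where
  "tderiv F x v = (\<lambda>i. if i < length F then frechet_derivative (peval (F ! i)) (at x) v else 0)"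

definition tang :: "real^'n \<Rightarrow> (real^'n) set" where
  "tang x = {v. v \<bullet> x = 0}"

definition deriv_surj :: "('n::finite) hpoly list \<Rightarrow> real^'n \<Rightarrow> bool" where
  "deriv_surj F x \<longleftrightarrow> (\<forall>w\<in>vecs (length F). \<exists>v\<in>tang x. tderiv F x v = w)"

text \<open>Moore-Penrose pseudoinverse of the (surjective) map DF(x)|_{T_x}:
  the minimal-norm preimage in T_x.\<close>
definition pinv_app :: "('n::finite) hpoly list \<Rightarrow> real^'n \<Rightarrow> (nat \<Rightarrow> real) \<Rightarrow> real^'n" where
  "pinv_app F x w = (THE v. v \<in> tang x \<and> tderiv F x v = w \<and>
      (\<forall>u. u \<in> tang x \<and> tderiv F x u = w \<longrightarrow> norm v \<le> norm u))"

definition Delta :: "('n::finite) hpoly list \<Rightarrow> (nat \<Rightarrow> real) \<Rightarrow> nat \<Rightarrow> real" where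
  "Delta F y = (\<lambda>i. if i < length F then sqrt (real (fst (F ! i))) * y i else 0)"

definition pinv_delta_norm :: "('n::finite) hpoly list \<Rightarrow> real^'n \<Rightarrow> real" where
  "pinv_delta_norm F x = Sup {norm (pinv_app F x (Delta F y)) | y. y \<in> vecs (length F) \<and> vnorm (length F) y \<le> 1}"

definition mu_proj :: "('n::finite) hpoly list \<Rightarrow> real^'n \<Rightarrow> ereal" where
  "mu_proj F x = (if deriv_surj F x then ereal (tnorm F * pinv_delta_norm F x) else \<infinity>)"

definition einv :: "ereal \<Rightarrow> ereal" where
  "einv t = (if t = \<infinity> then 0 else if t = 0 then \<infinity> else ereal (1 / real_of_ereal t))"

definition kappa_pt :: "('n::finite) hpoly list \<Rightarrow> real^'n \<Rightarrow> ereal" where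
  "kappa_pt F x =
     (if F \<noteq> [] \<and> (\<forall>p\<in>set F. \<forall>a. snd p a = 0) then \<infinity>
      else let m = mu_proj F x;
               m2 = (if m = \<infinity> then \<infinity> else ereal ((real_of_ereal m)^2));
               s = einv m2 + ereal ((vnorm (length F) (teval F x))^2 / (tnorm F)^2)
           in einv (if s = \<infinity> then \<infinity> else ereal (sqrt (real_of_ereal s))))"

definition kappa :: "('n::finite) hpoly list \<Rightarrow> ereal" where
  "kappa F = (SUP x\<in>sphere 0 1. kappa_pt F x)"

definition kappa_star :: "('n::finite) hpoly list \<Rightarrow> ('n::finite) hpoly list \<Rightarrow> ereal" where
  "kappa_star F G = (SUP I\<in>{I. I \<subseteq> {..<length G} \<and> length F + card I \<le> CARD('n)}.
       kappa (F @ nths G I))"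

definition SFG :: "('n::finite) hpoly list \<Rightarrow> ('n::finite) hpoly list \<Rightarrow> (real^'n) set" where
  "SFG F G = {x. norm x = 1 \<and> (\<forall>f\<in>set F. peval f x = 0) \<and> (\<forall>g\<in>set G. peval g x \<ge> 0)}"

definition dset :: "('a::metric_space) set \<Rightarrow> 'a \<Rightarrow> ereal" where
  "dset A x = (INF a\<in>A. ereal (dist x a))"

definition medial :: "('a::metric_space) set \<Rightarrow> 'a set" where
  "medial A = closure {x. \<exists>a b. a \<in> A \<and> b \<in> A \<and> a \<noteq> b \<and>
      ereal (dist x a) = dset A x \<and> ereal (dist x b) = dset A x}"

definition reach :: "('a::metric_space) set \<Rightarrow> ereal" where
  "reach A = (INF p\<in>A. dset (medial A) p)"

end

theory Submission
  imports Defs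
begin

text \<open>Let \<open>z\<close> have two distinct nearest points \<open>a, b\<close> in \<open>S\<close>, at distance \<open>r\<close>. As every point of \<open>S\<close> is
  at distance at least \<open>r\<close> from \<open>z\<close>, it suffices to bound \<open>r\<close> from below. Let \<open>H\<close> consist of \<open>F\<close> and the
  inequalities active at \<open>a\<close>, and let \<open>u\<close> be the component of \<open>b\<close> tangent to the sphere at \<open>a\<close>. Since
  \<open>H(a) = 0\<close>, the reproducing kernel of the Weyl inner product gives
  \<open>\<bar>f(b) - Df(a) u\<bar> \<le> d \<parallel>f\<parallel> \<parallel>b - a\<parallel>\<^sup>2\<close> for \<open>f \<in> H\<close> of degree \<open>d\<close>, so the pseudoinverse of \<open>DH(a)\<close>
  yields a tangent vector \<open>w\<close> of norm at most \<open>\<surd>D \<kappa>\<^sub>* \<parallel>b - a\<parallel>\<^sup>2\<close> with \<open>DH(a) (u + w) = H(b)\<close>. As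
  \<open>b \<in> S\<close>, the direction \<open>u + w\<close> is feasible at \<open>a\<close>, and minimality of \<open>a\<close> gives \<open>\<langle>z - a, u + w\<rangle> \<le> 0\<close>.
  On the other hand \<open>\<langle>z - a, u\<rangle> \<ge> (1 - r) \<parallel>b - a\<parallel>\<^sup>2 / 2\<close> because \<open>z\<close> is equidistant from \<open>a\<close> and \<open>b\<close>.
  Hence \<open>1 \<le> r (1 + 2 \<surd>D \<kappa>\<^sub>*)\<close>, which together with \<open>\<kappa>\<^sub>* \<ge> 1 / \<surd>2\<close> is stronger than the claim.\<close>

section \<open>Norm estimates for polynomials\<close>

definition mon :: "('n::finite \<Rightarrow> nat) \<Rightarrow> real^'n \<Rightarrow> real" where
  "mon a x = (\<Prod>i\<in>UNIV. (x $ i) ^ a i)"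

lemma finite_monoms [simp]: "finite (monoms d :: ('n::finite \<Rightarrow> nat) set)"
proof (rule finite_subset)
  show "monoms d \<subseteq> (UNIV::'n set) \<rightarrow>\<^sub>E {..d}"
    by (auto simp: monoms_def PiE_def intro!: member_le_sum)
qed (auto intro!: finite_PiE)

section \<open>Multinomial theorem and reproducing kernel\<close>

text \<open>The multinomial theorem divided by \<open>d!\<close>. With the factorials distributed
  over the factors, splitting off the exponent of \<open>j\<close> turns the induction step into the
  binomial theorem. Exponents vanish outside \<open>A\<close> so that each one is represented by a
  single function.\<close>

lemma sum_prod_pow_div_fact:
  fixes u :: "'i \<Rightarrow> real"
  assumes "finite A"
  shows "(\<Sum>a\<in>{a. (\<forall>i. i \<notin> A \<longrightarrow> a i = 0) \<and> sum a A = d}. \<Prod>i\<in>A. u i ^ a i / fact (a i))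
       = (\<Sum>i\<in>A. u i) ^ d / fact d"
  using assms
proof (induction A arbitrary: d rule: finite_induct)
  case empty
  show ?case
  proof (cases "d = 0")
    case True
    then have "{a. (\<forall>i. i \<notin> {} \<longrightarrow> a i = 0) \<and> sum a {} = d} = {\<lambda>i::'i. 0::nat}" by auto
    then show ?thesis using True by simp
  qed (simp add: power_0_left)
next
  case (insert j A)
  define E where "E B m = {a::'i \<Rightarrow> nat. (\<forall>i. i \<notin> B \<longrightarrow> a i = 0) \<and> sum a B = m}" for B m
  have fE: "finite (E B m)" if "finite B" for B m
  proof (rule finite_subset)
    show "E B m \<subseteq> {f. \<forall>x. (x \<in> B \<longrightarrow> f x \<in> {..m}) \<and> (x \<notin> B \<longrightarrow> f x = 0)}"
      using that by (auto simp: E_def intro!: member_le_sum)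
  qed (use that in \<open>simp only: finite_set_of_finite_funs finite_atMost\<close>)
  have "(\<Sum>a\<in>E (insert j A) d. \<Prod>i\<in>insert j A. u i ^ a i / fact (a i))
      = (\<Sum>(k,a)\<in>(SIGMA k:{..d}. E A (d - k)). u j ^ k / fact k * (\<Prod>i\<in>A. u i ^ a i / fact (a i)))"
  proof (rule sum.reindex_bij_witness[where i="\<lambda>(k,a). a(j := k)" and j="\<lambda>a. (a j, a(j := 0))"])
    fix a assume "a \<in> E (insert j A) d"
    then have a: "\<And>i. i \<noteq> j \<Longrightarrow> i \<notin> A \<Longrightarrow> a i = 0" "a j + sum a A = d"
      using insert by (auto simp: E_def)
    have s: "sum (a(j := 0)) A = sum a A" using insert by (intro sum.cong) auto
    show "(a j, a(j := 0)) \<in> (SIGMA k:{..d}. E A (d - k))"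
      using a s by (auto simp: E_def)
    show "(case (a j, a(j := 0)) of (k,a) \<Rightarrow> u j ^ k / fact k * (\<Prod>i\<in>A. u i ^ a i / fact (a i)))
       = (\<Prod>i\<in>insert j A. u i ^ a i / fact (a i))"
    proof -
      have "(\<Prod>i\<in>A. u i ^ (a(j := 0)) i / fact ((a(j := 0)) i)) = (\<Prod>i\<in>A. u i ^ a i / fact (a i))"
        using insert by (intro prod.cong) auto
      then show ?thesis using insert by simp
    qed
  next
    fix p assume "p \<in> (SIGMA k:{..d}. E A (d - k))"
    then obtain k a where p: "p = (k,a)" "k \<le> d" "\<And>i. i \<notin> A \<Longrightarrow> a i = 0" "sum a A = d - k"
      by (auto simp: E_def)
    have s: "sum (a(j := k)) A = sum a A" using insert by (intro sum.cong) auto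
    show "(case p of (k,a) \<Rightarrow> a(j := k)) \<in> E (insert j A) d"
      using p s insert by (auto simp: E_def)
    show "(\<lambda>a. (a j, a(j := 0))) (case p of (k,a) \<Rightarrow> a(j := k)) = p"
      using p insert by auto
  qed auto
  also have "\<dots> = (\<Sum>k\<le>d. u j ^ k / fact k * ((\<Sum>i\<in>A. u i) ^ (d - k) / fact (d - k)))"
    using insert.hyps fE
    by (simp add: sum.Sigma[symmetric] sum_distrib_left[symmetric] insert.IH[folded E_def]
        del: times_divide_eq_left times_divide_eq_right)
  also have "\<dots> = (u j + (\<Sum>i\<in>A. u i)) ^ d / fact d"
    unfolding binomial_ring sum_divide_distrib
    by (rule sum.cong) (simp_all add: binomial_fact)
  finally show ?case using insert by (simp add: E_def)
qed

text \<open>The power \<open>(x \<bullet> y) ^ d\<close> is the reproducing kernel of the Weyl inner product;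
  all norm estimates on polynomials come from differentiating this identity in \<open>x\<close> and \<open>y\<close>.\<close>

lemma mon_kernel:
  "(\<Sum>a\<in>monoms d. multinom d a * (mon a x * mon a y)) = (x \<bullet> y) ^ d"
proof -
  have "(\<Sum>a\<in>monoms d. multinom d a * (mon a x * mon a y))
      = fact d * (\<Sum>a\<in>monoms d. \<Prod>i\<in>UNIV. (x $ i * y $ i) ^ a i / fact (a i))"
    by (simp add: multinom_def mon_def sum_distrib_left prod_dividef prod.distrib power_mult_distrib)
  also have "\<dots> = (\<Sum>i\<in>UNIV. x $ i * y $ i) ^ d"
    using sum_prod_pow_div_fact[of UNIV "\<lambda>i. x $ i * y $ i" d] by (simp add: monoms_def)
  finally show ?thesis by (simp add: inner_vec_def)
qed

lemma differentiable_mon: "mon a differentiable (at x)"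
  unfolding mon_def[abs_def] differentiable_def
  by (rule exI, rule has_derivative_prod, rule has_derivative_power,
      rule bounded_linear_imp_has_derivative, rule bounded_linear_vec_nth)

definition dmon :: "('n::finite \<Rightarrow> nat) \<Rightarrow> real^'n \<Rightarrow> real^'n \<Rightarrow> real" where
  "dmon a x v = frechet_derivative (mon a) (at x) v"

lemma has_derivative_mon: "(mon a has_derivative dmon a x) (at x)"
  using frechet_derivative_works differentiable_mon unfolding dmon_def[abs_def] by blast

lemma dmon_kernel:
  "(\<Sum>a\<in>monoms d. multinom d a * (mon a y * dmon a x v)) = d * (y \<bullet> x) ^ (d - 1) * (y \<bullet> v)"
proof -
  have "((\<lambda>x. \<Sum>a\<in>monoms d. multinom d a * (mon a y * mon a x)) has_derivative
        (\<lambda>v. \<Sum>a\<in>monoms d. multinom d a * (mon a y * dmon a x v))) (at x)"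
    by (auto intro!: derivative_eq_intros has_derivative_mon)
  moreover have "((\<lambda>x. (y \<bullet> x) ^ d) has_derivative (\<lambda>v. d * (y \<bullet> x) ^ (d - 1) * (y \<bullet> v))) (at x)"
    by (auto intro!: derivative_eq_intros simp: mult_ac)
  ultimately show ?thesis
    unfolding mon_kernel by (rule fun_cong[OF has_derivative_unique])
qed

text \<open>Differentiates \<open>dmon_kernel\<close> in \<open>y\<close> at \<open>x\<close>. The
  term coming from the power carries a factor \<open>x \<bullet> v\<close>, which tangency
  removes.\<close>

lemma dmon_dmon_kernel:
  assumes "norm x = 1" "v \<bullet> x = 0"
  shows "(\<Sum>a\<in>monoms d. multinom d a * (dmon a x v)\<^sup>2) = d * (v \<bullet> v)"
proof -
  have "((\<lambda>y. \<Sum>a\<in>monoms d. multinom d a * (mon a y * dmon a x v)) has_derivative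
        (\<lambda>w. \<Sum>a\<in>monoms d. multinom d a * (dmon a x w * dmon a x v))) (at x)"
    by (auto intro!: derivative_eq_intros has_derivative_mon)
  moreover have "((\<lambda>y. d * (y \<bullet> x) ^ (d - 1) * (y \<bullet> v)) has_derivative
     (\<lambda>w. d * (x \<bullet> x) ^ (d - 1) * (w \<bullet> v) + d * (of_nat (d - 1) * (x \<bullet> x) ^ (d - 1 - 1) * (w \<bullet> x)) * (x \<bullet> v))) (at x)"
    by (auto intro!: derivative_eq_intros simp: algebra_simps)
  ultimately have "(\<Sum>a\<in>monoms d. multinom d a * (dmon a x v * dmon a x v)) =
    d * (x \<bullet> x) ^ (d - 1) * (v \<bullet> v) + d * (of_nat (d - 1) * (x \<bullet> x) ^ (d - 1 - 1) * (v \<bullet> x)) * (x \<bullet> v)"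
    unfolding dmon_kernel by (rule fun_cong[OF has_derivative_unique])
  then show ?thesis using assms by (simp add: power2_eq_square dot_square_norm)
qed

lemma peval_mon: "peval p x = (\<Sum>a\<in>monoms (fst p). snd p a * mon a x)"
  by (simp add: peval_def mon_def)

lemma has_derivative_peval:
  "(peval p has_derivative (\<lambda>v. \<Sum>a\<in>monoms (fst p). snd p a * dmon a x v)) (at x)"
  unfolding peval_mon[abs_def] by (auto intro!: derivative_eq_intros has_derivative_mon)

abbreviation Dpeval :: "('n::finite) hpoly \<Rightarrow> real^'n \<Rightarrow> real^'n \<Rightarrow> real" where
  "Dpeval p x \<equiv> frechet_derivative (peval p) (at x)"

lemma Dpeval_works: "(peval p has_derivative Dpeval p x) (at x)"
  using has_derivative_peval frechet_derivative_works differentiable_def by blast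

lemma Dpeval_mon: "Dpeval p x v = (\<Sum>a\<in>monoms (fst p). snd p a * dmon a x v)"
  using has_derivative_unique[OF Dpeval_works has_derivative_peval] by metis

lemma linear_Dpeval: "linear (Dpeval p x)"
  using Dpeval_works has_derivative_linear by blast

lemma continuous_on_peval: "continuous_on A (peval p)"
  by (intro continuous_at_imp_continuous_on ballI has_derivative_continuous[OF Dpeval_works])

section \<open>Dual norms of evaluation, derivative and Taylor remainder\<close>

lemma weyl_sq_nonneg [simp]: "0 \<le> weyl_sq p"
  unfolding weyl_sq_def multinom_def by (intro sum_nonneg divide_nonneg_nonneg prod_nonneg) auto

text \<open>Cauchy-Schwarz after splitting each weight \<open>multinom\<close> into two square
  roots. The second factor is the squared dual norm of the functional with values \<open>h\<close>
  on monomials; the kernel identities evaluate it.\<close>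

lemma weyl_Cauchy_Schwarz:
  "(\<Sum>a\<in>monoms (fst p). snd p a * h a)\<^sup>2 \<le> weyl_sq p * (\<Sum>a\<in>monoms (fst p). multinom (fst p) a * (h a)\<^sup>2)"
proof -
  define m where "m a = multinom (fst p) a" for a :: "'a \<Rightarrow> nat"
  have m: "m a > 0" for a unfolding m_def multinom_def by (auto intro!: divide_pos_pos prod_pos)
  have "(\<Sum>a\<in>monoms (fst p). (snd p a / sqrt (m a)) * (sqrt (m a) * h a))\<^sup>2
     \<le> (\<Sum>a\<in>monoms (fst p). (snd p a / sqrt (m a))\<^sup>2) * (\<Sum>a\<in>monoms (fst p). (sqrt (m a) * h a)\<^sup>2)"
    by (rule Cauchy_Schwarz_ineq_sum)
  moreover have "(snd p a / sqrt (m a)) * (sqrt (m a) * h a) = snd p a * h a"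
    "(snd p a / sqrt (m a))\<^sup>2 = (snd p a)\<^sup>2 / m a" "(sqrt (m a) * h a)\<^sup>2 = m a * (h a)\<^sup>2" for a
    using m[of a] by (simp_all add: power_divide power_mult_distrib)
  ultimately show ?thesis by (simp add: weyl_sq_def m_def)
qed

lemma peval_bound:
  assumes "norm x = 1"
  shows "(peval p x)\<^sup>2 \<le> weyl_sq p"
  using weyl_Cauchy_Schwarz[of p "\<lambda>a. mon a x"] mon_kernel[of "fst p" x x] assms
  by (simp add: peval_mon power2_eq_square dot_square_norm)

lemma Dpeval_bound:
  assumes "norm x = 1" "v \<in> tang x"
  shows "(Dpeval p x v)\<^sup>2 \<le> weyl_sq p * (real (fst p) * (norm v)\<^sup>2)"
  using weyl_Cauchy_Schwarz[of p "\<lambda>a. dmon a x v"] dmon_dmon_kernel[of x v "fst p"] assms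
  by (simp add: Dpeval_mon tang_def power2_norm_eq_inner)

lemma peval_scaleR: "peval p (t *\<^sub>R x) = t ^ fst p * peval p x"
proof -
  have "mon a (t *\<^sub>R x) = t ^ fst p * mon a x" if "a \<in> monoms (fst p)" for a
    using that by (simp add: mon_def monoms_def power_mult_distrib prod.distrib power_sum[symmetric])
  then show ?thesis by (simp add: peval_mon sum_distrib_left mult_ac)
qed

lemma Dpeval_radial_zero:
  assumes "peval p x = 0"
  shows "Dpeval p x x = 0"
proof -
  have "((\<lambda>t. peval p (t *\<^sub>R x)) has_derivative (\<lambda>s. Dpeval p x (s *\<^sub>R x))) (at (1::real))"
    by (rule has_derivative_compose[of "\<lambda>t. t *\<^sub>R x" _ _ _ "peval p", simplified])
       (auto intro!: derivative_eq_intros Dpeval_works)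
  moreover have "((\<lambda>t::real. peval p (t *\<^sub>R x)) has_derivative (\<lambda>s. 0)) (at 1)"
    by (simp add: peval_scaleR assms)
  ultimately have "(\<lambda>s. Dpeval p x (s *\<^sub>R x)) = (\<lambda>s. 0)" by (rule has_derivative_unique)
  from fun_cong[OF this, of 1] show ?thesis by simp
qed

lemma one_minus_power_le:
  fixes c :: real
  assumes "\<bar>c\<bar> \<le> 1"
  shows "1 - c ^ m \<le> m * (1 - c)"
proof -
  have "1 - c ^ m = (1 - c) * (\<Sum>i<m. c ^ i)" by (rule one_diff_power_eq)
  also have "\<dots> \<le> (1 - c) * (\<Sum>i<m. 1)"
  proof (intro mult_left_mono sum_mono)
    fix i
    have "\<bar>c ^ i\<bar> \<le> 1" using assms by (simp add: power_abs power_le_one)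
    then show "c ^ i \<le> 1" by linarith
  qed (use assms in auto)
  finally show ?thesis by (simp add: mult.commute)
qed

text \<open>The remainder is linear in the coefficients, so Cauchy-Schwarz reduces the estimate to a
  dual norm that depends on \<open>p\<close> only through its degree.\<close>

lemma peval_taylor_bound:
  assumes a: "norm a = 1" and b: "norm b = 1" and p: "peval p a = 0"
  shows "(peval p b - Dpeval p a (b - (a \<bullet> b) *\<^sub>R a))\<^sup>2 \<le> weyl_sq p * ((real (fst p))\<^sup>2 * norm (b - a) ^ 4)"
proof -
  define c v d where "c = a \<bullet> b" and "v = b - c *\<^sub>R a" and "d = fst p"
  \<comment> \<open>The functional \<open>p \<mapsto> peval p b - c ^ d * peval p a - Dpeval p a v\<close> is the pairing with \<open>h\<close>.
    Its middle term vanishes here, but the radial component it cancels is what makes \<open>h\<close> of second order in \<open>b - a\<close>.\<close>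
  define h where "h m = mon m b - c ^ d * mon m a - dmon m a v" for m
  have aa: "a \<bullet> a = 1" and bb: "b \<bullet> b = 1" using a b by (simp_all add: dot_square_norm)
  have va: "v \<bullet> a = 0" and vb: "v \<bullet> b = 1 - c\<^sup>2" and vv: "v \<bullet> v = 1 - c\<^sup>2"
    using aa bb by (simp_all add: v_def c_def inner_diff inner_commute power2_eq_square algebra_simps)
  have c: "\<bar>c\<bar> \<le> 1" using Cauchy_Schwarz_ineq2[of a b] a b by (simp add: c_def)
  have c2: "c\<^sup>2 \<le> 1" using c by (simp add: abs_square_le_1)
  have ab: "norm (b - a) ^ 4 = (2 - 2 * c)\<^sup>2"
  proof -
    have "(norm (b - a))\<^sup>2 = 2 - 2 * c"
      using aa bb by (simp add: power2_norm_eq_inner inner_diff c_def inner_commute)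
    then show ?thesis by (metis mult_2 numeral_Bit0 power2_eq_square power_add)
  qed
  have "(\<Sum>m\<in>monoms d. multinom d m * (h m)\<^sup>2) =
      (\<Sum>m\<in>monoms d. multinom d m * (mon m b * mon m b))
      + (c ^ d)\<^sup>2 * (\<Sum>m\<in>monoms d. multinom d m * (mon m a * mon m a))
      + (\<Sum>m\<in>monoms d. multinom d m * (dmon m a v)\<^sup>2)
      - 2 * c ^ d * (\<Sum>m\<in>monoms d. multinom d m * (mon m a * mon m b))
      - 2 * (\<Sum>m\<in>monoms d. multinom d m * (mon m b * dmon m a v))
      + 2 * c ^ d * (\<Sum>m\<in>monoms d. multinom d m * (mon m a * dmon m a v))"
    unfolding sum_distrib_left sum.distrib[symmetric] sum_subtractf[symmetric]
    by (rule sum.cong) (auto simp: h_def power2_eq_square algebra_simps)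
  also have "\<dots> = 1 - (c ^ d)\<^sup>2 + d * (1 - c\<^sup>2) - 2 * (d * c ^ (d - 1) * (1 - c\<^sup>2))"
    unfolding mon_kernel dmon_kernel dmon_dmon_kernel[OF a va]
    using va vb vv aa bb by (simp add: inner_commute c_def[symmetric] power2_eq_square)
  \<comment> \<open>\<open>1 - (c ^ d)\<^sup>2\<close> is absorbed into a second
    \<open>d * (1 - c\<^sup>2)\<close>, leaving a product of two factors of order
    \<open>1 - c\<close>. As the squared distance of \<open>a\<close> and \<open>b\<close> is
    \<open>2 - 2 * c\<close>, this yields the fourth power.\<close>
  also have "\<dots> \<le> 2 * (d * (1 - c\<^sup>2)) * (1 - c ^ (d - 1))"
  proof -
    have "1 - (c\<^sup>2) ^ d \<le> d * (1 - c\<^sup>2)" using c2 by (intro one_minus_power_le) auto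
    moreover have "(c\<^sup>2) ^ d = (c ^ d)\<^sup>2" by (simp add: power_mult[symmetric] mult.commute)
    ultimately show ?thesis by (simp add: algebra_simps)
  qed
  also have "\<dots> \<le> 2 * (d * (2 * (1 - c))) * (d * (1 - c))"
  proof (intro mult_mono)
    show "1 - c\<^sup>2 \<le> 2 * (1 - c)" using zero_le_power2[of "1 - c"] by (simp add: power2_diff)
    have "1 - c ^ (d - 1) \<le> real (d - 1) * (1 - c)" using one_minus_power_le c by blast
    also have "\<dots> \<le> d * (1 - c)" using c by (intro mult_right_mono) auto
    finally show "1 - c ^ (d - 1) \<le> d * (1 - c)" .
    have "\<bar>c ^ (d - 1)\<bar> \<le> 1" using c by (simp add: power_abs power_le_one)
    then show "0 \<le> 1 - c ^ (d - 1)" by linarith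
  qed (use c c2 in auto)
  also have "\<dots> = (real d)\<^sup>2 * norm (b - a) ^ 4"
    unfolding ab by (simp add: power2_eq_square algebra_simps)
  finally have "weyl_sq p * (\<Sum>m\<in>monoms d. multinom d m * (h m)\<^sup>2) \<le> weyl_sq p * ((real d)\<^sup>2 * norm (b - a) ^ 4)"
    by (intro mult_left_mono) auto
  moreover have "(\<Sum>m\<in>monoms d. snd p m * h m) = peval p b - c ^ d * peval p a - Dpeval p a v"
    unfolding peval_mon Dpeval_mon sum_distrib_left sum_subtractf[symmetric] d_def[symmetric]
    by (rule sum.cong) (auto simp: h_def algebra_simps)
  ultimately show ?thesis
    using weyl_Cauchy_Schwarz[of p h] p by (simp add: d_def v_def c_def)
qed

section \<open>First-order conditions and pseudoinverses\<close>

text \<open>A Brouwer fixed point of \<open>x \<mapsto> a + t v - \<psi> x\<close>, where \<open>\<psi>\<close> is of second order at \<open>a\<close>,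
  replaces the implicit function theorem.\<close>

lemma approx_curve_in_constraints:
  fixes a v :: "'a::euclidean_space" and \<phi> \<phi>' :: "'i \<Rightarrow> 'a \<Rightarrow> real"
  assumes I: "finite I"
    and cont: "\<And>i. i \<in> I \<Longrightarrow> continuous_on UNIV (\<phi> i)"
    and der: "\<And>i. i \<in> I \<Longrightarrow> (\<phi> i has_derivative \<phi>' i) (at a)"
    and zero: "\<And>i. i \<in> I \<Longrightarrow> \<phi> i a = 0"
    and dual: "\<And>i j. i \<in> I \<Longrightarrow> j \<in> I \<Longrightarrow> \<phi>' j (n i) = (if i = j then 1 else 0)"
    and e: "e > 0"
  shows "\<exists>d>0. \<forall>t. 0 < t \<and> t < d \<longrightarrow>
           (\<exists>x. norm (x - a - t *\<^sub>R v) \<le> e * t \<and> (\<forall>i\<in>I. \<phi> i x = t * \<phi>' i v))"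
proof -
  \<comment> \<open>\<open>\<psi>\<close> carries the nonlinear remainders along the dual vectors,
    so \<open>\<phi>' j\<close> recovers the remainder of \<open>\<phi> j\<close> from it. A fixed
    point satisfies \<open>x - a = t *\<^sub>R v - \<psi> x\<close>, and applying
    \<open>\<phi>' j\<close> gives \<open>\<phi> j x = t * \<phi>' j v\<close>.\<close>
  define \<psi> where "\<psi> x = (\<Sum>i\<in>I. (\<phi> i x - \<phi>' i (x - a)) *\<^sub>R n i)" for x
  have lin: "linear (\<phi>' i)" if "i \<in> I" for i using der[OF that] has_derivative_linear by blast
  have "(\<psi> has_derivative (\<lambda>h. \<Sum>i\<in>I. (\<phi>' i h - \<phi>' i (h - 0)) *\<^sub>R n i)) (at a)"
    unfolding \<psi>_def
    by (intro has_derivative_sum has_derivative_scaleR_left has_derivative_diff der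
        linear_imp_has_derivative has_derivative_compose[where g="\<phi>' _" and f="\<lambda>x. x - a"]
        has_derivative_ident has_derivative_const) (use lin in \<open>auto intro: linear_imp_has_derivative\<close>)
  then have "(\<psi> has_derivative (\<lambda>h. 0)) (at a)" by simp
  moreover have "\<psi> a = 0" unfolding \<psi>_def using zero lin by (simp add: linear_0)
  \<comment> \<open>The ball of radius \<open>e * t\<close> about \<open>a + t *\<^sub>R v\<close>
    lies within \<open>t * (norm v + e)\<close> of \<open>a\<close>; this \<open>\<epsilon>\<close>
    bounds \<open>\<psi>\<close> there by \<open>e * t\<close>, so the map preserves the
    ball.\<close>
  moreover define \<epsilon> where "\<epsilon> = e / (norm v + e)"
  have nve: "norm v + e > 0" using e by (simp add: add_nonneg_pos)
  then have "\<epsilon> > 0" using e by (simp add: \<epsilon>_def)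
  ultimately obtain d where d: "d > 0" "\<And>x. norm (x - a) < d \<Longrightarrow> norm (\<psi> x) \<le> \<epsilon> * norm (x - a)"
    unfolding has_derivative_at_alt by auto
  have cont\<psi>: "continuous_on UNIV \<psi>"
    unfolding \<psi>_def
    by (intro continuous_intros cont linear_continuous_on_compose[where g="\<phi>' _"])
       (use lin in auto)
  show ?thesis
  proof (rule exI[of _ "d / (norm v + e)"], intro conjI allI impI)
    show "d / (norm v + e) > 0" using d nve by simp
    fix t assume t: "0 < t \<and> t < d / (norm v + e)"
    define T where "T x = a + t *\<^sub>R v - \<psi> x" for x
    have "continuous_on (cball (a + t *\<^sub>R v) (e * t)) T"
      unfolding T_def by (intro continuous_intros continuous_on_subset[OF cont\<psi>]) auto
    moreover have "T \<in> cball (a + t *\<^sub>R v) (e * t) \<rightarrow> cball (a + t *\<^sub>R v) (e * t)"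
    proof
      fix x assume "x \<in> cball (a + t *\<^sub>R v) (e * t)"
      then have "norm (x - a - t *\<^sub>R v) \<le> e * t"
        by (simp add: dist_norm norm_minus_commute diff_diff_eq)
      moreover have "norm (x - a) \<le> norm (x - a - t *\<^sub>R v) + norm (t *\<^sub>R v)"
        using norm_triangle_ineq[of "x - a - t *\<^sub>R v" "t *\<^sub>R v"] by simp
      ultimately have x: "norm (x - a) \<le> t * (norm v + e)" using t by (simp add: algebra_simps)
      also have "\<dots> < d" using t nve by (simp add: pos_less_divide_eq)
      finally have "norm (\<psi> x) \<le> \<epsilon> * norm (x - a)" by (rule d)
      also have "\<dots> \<le> \<epsilon> * (t * (norm v + e))" using x \<open>\<epsilon> > 0\<close> by (intro mult_left_mono) auto
      also have "\<dots> = e * t" using nve by (simp add: \<epsilon>_def)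
      finally show "T x \<in> cball (a + t *\<^sub>R v) (e * t)" by (simp add: T_def dist_norm)
    qed
    ultimately obtain x where x: "x \<in> cball (a + t *\<^sub>R v) (e * t)" "T x = x"
      using brouwer_ball[of "e * t" "a + t *\<^sub>R v" T] e t by auto
    have "\<phi> j x = t * \<phi>' j v" if j: "j \<in> I" for j
    proof -
      have eq: "x - a = t *\<^sub>R v - \<psi> x" using x(2) by (simp add: T_def algebra_simps)
      have "\<phi>' j (\<psi> x) = (\<Sum>i\<in>I. (\<phi> i x - \<phi>' i (x - a)) * \<phi>' j (n i))"
        unfolding \<psi>_def using lin[OF j] by (simp add: linear_sum linear_scale)
      also have "\<dots> = (\<Sum>i\<in>I. if i = j then \<phi> i x - \<phi>' i (x - a) else 0)"
        using dual j by (intro sum.cong) auto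
      finally have "\<phi>' j (\<psi> x) = \<phi> j x - \<phi>' j (x - a)" using I j by simp
      moreover have "\<phi>' j (x - a) = t * \<phi>' j v - \<phi>' j (\<psi> x)"
        unfolding eq using lin[OF j] by (simp add: linear_diff linear_scale)
      ultimately show ?thesis by simp
    qed
    moreover have "norm (x - a - t *\<^sub>R v) \<le> e * t"
      using x(1) by (simp add: dist_norm norm_minus_commute diff_diff_eq)
    ultimately show "\<exists>x. norm (x - a - t *\<^sub>R v) \<le> e * t \<and> (\<forall>i\<in>I. \<phi> i x = t * \<phi>' i v)"
      by blast
  qed
qed

text \<open>Were the product a positive \<open>c\<close>, moving by \<open>t *\<^sub>R v\<close>
  would shrink the squared distance by about \<open>2 * t * c\<close>, more than the curve error and
  the squared step can restore.\<close>

lemma nearest_point_first_order: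
  fixes a z v :: "'a::real_inner"
  assumes near: "\<And>x. x \<in> S \<Longrightarrow> norm (z - a) \<le> norm (z - x)"
    and dir: "\<And>e. e > 0 \<Longrightarrow> \<exists>d>0. \<forall>t. 0 < t \<and> t < d \<longrightarrow> (\<exists>x\<in>S. norm (x - a - t *\<^sub>R v) \<le> e * t)"
  shows "(z - a) \<bullet> v \<le> 0"
proof (rule ccontr)
  define c where "c = (z - a) \<bullet> v"
  assume "\<not> (z - a) \<bullet> v \<le> 0"
  then have c: "c > 0" by (simp add: c_def)
  \<comment> \<open>\<open>e\<close> keeps the error term at most \<open>t * c / 4\<close>, and
    \<open>t * q \<le> c\<close> below keeps the squared step at most \<open>t * c\<close>. Then
    twice \<open>(z - a) \<bullet> h\<close> is at least \<open>3/2 * t * c\<close>, against the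
    upper bound \<open>t * c\<close> from minimality.\<close>
  define e where "e = c / (4 * (norm (z - a) + 1))"
  have den: "4 * (norm (z - a) + 1) > 0" by (simp add: add_nonneg_pos)
  have e: "e > 0" using c den by (simp add: e_def)
  have "e * (4 * (norm (z - a) + 1)) = c" using den by (simp add: e_def)
  then have ze: "norm (z - a) * e \<le> c / 4" using e by (simp add: algebra_simps)
  obtain d where d: "d > 0" "\<And>t. 0 < t \<Longrightarrow> t < d \<Longrightarrow> \<exists>x\<in>S. norm (x - a - t *\<^sub>R v) \<le> e * t"
    using dir[OF e] by blast
  define q where "q = (norm v + e)\<^sup>2 + 1"
  have q: "q > 0" by (simp add: q_def add_nonneg_pos)
  define t where "t = min (d / 2) (c / q)"
  have t: "0 < t" "t < d" "t * q \<le> c"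
    using d(1) c q by (auto simp: t_def min_def field_simps)
  obtain x where x: "x \<in> S" "norm (x - a - t *\<^sub>R v) \<le> e * t" using d t by blast
  define h where "h = x - a"
  have hx: "norm (h - t *\<^sub>R v) \<le> e * t" using x by (simp add: h_def)
  have "norm h \<le> norm (h - t *\<^sub>R v) + norm (t *\<^sub>R v)" by (metis diff_add_cancel norm_triangle_ineq)
  then have "norm h \<le> t * (norm v + e)" using hx t by (simp add: algebra_simps)
  then have "(norm h)\<^sup>2 \<le> (t * (norm v + e))\<^sup>2" by (intro power_mono) auto
  also have "\<dots> \<le> t * (t * q)" using t by (simp add: q_def power2_eq_square algebra_simps)
  also have "\<dots> \<le> t * c" using t by (intro mult_left_mono) auto
  finally have hh: "h \<bullet> h \<le> t * c" by (simp add: power2_norm_eq_inner)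
  have "norm (z - a) \<le> norm (z - a - h)" using near[OF x(1)] by (simp add: h_def)
  then have "(z - a) \<bullet> (z - a) \<le> (z - a - h) \<bullet> (z - a - h)" by (simp add: norm_le)
  then have 1: "2 * ((z - a) \<bullet> h) \<le> h \<bullet> h"
    by (simp only: inner_diff_left[of "z - a" h] inner_diff_right[of _ "z - a" h] inner_commute[of h "z - a"])
  have "(z - a) \<bullet> h = t * c + (z - a) \<bullet> (h - t *\<^sub>R v)"
    by (simp only: inner_diff_right[of _ h] c_def) simp
  moreover have "\<bar>(z - a) \<bullet> (h - t *\<^sub>R v)\<bar> \<le> norm (z - a) * (e * t)"
    using Cauchy_Schwarz_ineq2[of "z - a" "h - t *\<^sub>R v"] mult_left_mono[OF hx norm_ge_zero[of "z - a"]]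
    by linarith
  moreover have "norm (z - a) * (e * t) \<le> t * c / 4"
    using mult_right_mono[OF ze, of t] t by (simp add: algebra_simps)
  moreover have "k \<le> 0"
    if "p = k + p'" "\<bar>p'\<bar> \<le> m" "m \<le> k / 4" "2 * p \<le> s" "s \<le> k" for k p p' m s :: real
    using that by linarith
  ultimately have "t * c \<le> 0" using 1 hh by blast
  then show False using c t by (simp add: mult_le_0_iff)
qed

section \<open>Dual vectors and the Moore-Penrose inverse\<close>

text \<open>Preimages of the unit vectors. In this form surjectivity enters the fixed-point
  argument, the dimension count and the boundedness of the pseudoinverse.\<close>

lemma deriv_surj_dual_vectors:
  assumes "deriv_surj H x"
  shows "\<exists>n. (\<forall>i<length H. n i \<in> tang x) \<and>
    (\<forall>i<length H. \<forall>j<length H. Dpeval (H ! j) x (n i) = (if i = j then 1 else 0))"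
proof -
  have "\<exists>v\<in>tang x. tderiv H x v = (\<lambda>j. if j = i then 1 else 0)" if "i < length H" for i
    using assms that unfolding deriv_surj_def by (auto simp: vecs_def)
  then obtain n where n: "\<And>i. i < length H \<Longrightarrow> n i \<in> tang x \<and> tderiv H x (n i) = (\<lambda>j. if j = i then 1 else 0)"
    by metis
  have "Dpeval (H ! j) x (n i) = (if i = j then 1 else 0)" if "i < length H" "j < length H" for i j
    using fun_cong[OF conjunct2[OF n[OF that(1)]], of j] that by (auto simp: tderiv_def)
  then show ?thesis using n by blast
qed

lemma linear_biorthogonal_independent:
  fixes n :: "'i \<Rightarrow> 'a::euclidean_space" and \<phi> :: "'i \<Rightarrow> 'a \<Rightarrow> real"
  assumes I: "finite I" and lin: "\<And>i. i \<in> I \<Longrightarrow> linear (\<phi> i)"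
    and dual: "\<And>i j. i \<in> I \<Longrightarrow> j \<in> I \<Longrightarrow> \<phi> j (n i) = (if i = j then 1 else 0)"
  shows "inj_on n I" "independent (n ` I)"
proof -
  show inj: "inj_on n I"
    by (rule inj_onI) (metis dual zero_neq_one)
  show "independent (n ` I)"
  proof (rule independent_if_scalars_zero)
    fix f x assume s: "(\<Sum>v\<in>n ` I. f v *\<^sub>R v) = 0" and "x \<in> n ` I"
    then obtain j where j: "j \<in> I" "x = n j" by blast
    have "0 = \<phi> j (\<Sum>i\<in>I. f (n i) *\<^sub>R n i)"
      using s inj lin[OF j(1)] by (simp add: sum.reindex linear_0)
    also have "\<dots> = (\<Sum>i\<in>I. f (n i) * \<phi> j (n i))"
      using lin[OF j(1)] by (simp add: linear_sum linear_scale)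
    also have "\<dots> = (\<Sum>i\<in>I. if i = j then f (n i) else 0)"
      using dual j by (intro sum.cong) auto
    finally show "f x = 0" using I j by simp
  qed (use I in auto)
qed

text \<open>The dual vectors are independent and lie in the hyperplane orthogonal to
  \<open>x\<close>; the inequality is strict because the radial direction is lost.\<close>

lemma deriv_surj_length_less:
  fixes x :: "real^'n::finite"
  assumes "deriv_surj H x" "x \<noteq> 0"
  shows "length H < CARD('n)"
proof -
  obtain n where n: "\<And>i. i < length H \<Longrightarrow> n i \<in> tang x"
    "\<And>i j. i < length H \<Longrightarrow> j < length H \<Longrightarrow> Dpeval (H ! j) x (n i) = (if i = j then 1 else 0)"
    using deriv_surj_dual_vectors[OF assms(1)] by blast
  have "inj_on n {..<length H}" and ind: "independent (n ` {..<length H})"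
    by (rule linear_biorthogonal_independent[of _ "\<lambda>j. Dpeval (H ! j) x"]; simp add: n linear_Dpeval)+
  then have "length H = card (n ` {..<length H})" by (simp add: card_image)
  also have "\<dots> \<le> dim (tang x)" using n(1) by (intro independent_card_le_dim ind) auto
  also have "tang x = {v. x \<bullet> v = 0}" by (auto simp: tang_def inner_commute)
  also have "dim {v. x \<bullet> v = 0} = CARD('n) - 1" using dim_hyperplane[OF assms(2)] by simp
  finally show ?thesis using zero_less_card_finite[where 'a='n] by linarith
qed

lemma subspace_tang: "subspace (tang x)"
  by (auto simp: tang_def subspace_def inner_left_distrib)

text \<open>The fibre over \<open>w\<close> in the tangent space is nonempty, closed and convex, so
  it has a unique point nearest to 0 and the description in \<open>pinv_app\<close> is well
  defined.\<close>

lemma pinv_app_works: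
  fixes x :: "real^'n::finite"
  assumes "deriv_surj H x" "w \<in> vecs (length H)"
  shows pinv_app_in_tang: "pinv_app H x w \<in> tang x"
    and tderiv_pinv_app: "tderiv H x (pinv_app H x w) = w"
    and norm_pinv_app_le: "\<And>u. u \<in> tang x \<Longrightarrow> tderiv H x u = w \<Longrightarrow> norm (pinv_app H x w) \<le> norm u"
proof -
  define A where "A = {u \<in> tang x. tderiv H x u = w}"
  have A: "A = tang x \<inter> (\<Inter>i\<in>{..<length H}. {u. Dpeval (H ! i) x u = w i})"
    using assms(2) by (auto simp: A_def tderiv_def vecs_def fun_eq_iff)
  have closed: "closed A"
    unfolding A
    by (intro closed_Int closed_INT ballI closed_subspace subspace_tang closed_Collect_eq
        linear_continuous_on linear_conv_bounded_linear[THEN iffD1] linear_Dpeval continuous_on_const)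
  have convex: "convex A"
    unfolding A
  proof (intro convex_Int convex_INT subspace_imp_convex[OF subspace_tang])
    fix i
    have "{u. Dpeval (H ! i) x u = w i} = Dpeval (H ! i) x -` {w i}" by auto
    then show "convex {u. Dpeval (H ! i) x u = w i}"
      using convex_linear_vimage[OF linear_Dpeval] convex_singleton by metis
  qed
  have ne: "A \<noteq> {}" using assms by (auto simp: A_def deriv_surj_def)
  define v where "v = closest_point A 0"
  have v: "v \<in> A" "\<forall>u\<in>A. dist 0 v \<le> dist 0 u"
    unfolding v_def by (fact closest_point_exists[OF closed ne])+
  have "v' = v" if "v' \<in> A" "\<forall>u\<in>A. norm v' \<le> norm u" for v'
  proof (rule any_closest_point_unique[OF convex closed that(1) v(1) _ v(2)])
    show "\<forall>u\<in>A. dist 0 v' \<le> dist 0 u" using that(2) by (simp only: dist_0_norm)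
  qed
  moreover have "\<forall>u\<in>A. norm v \<le> norm u" using v(2) by (simp only: dist_0_norm)
  ultimately have "\<exists>!v. v \<in> A \<and> (\<forall>u\<in>A. norm v \<le> norm u)"
    using v(1) by (intro ex1I[of _ v] conjI) (assumption+, blast)
  then have "\<exists>!v. v \<in> tang x \<and> tderiv H x v = w \<and> (\<forall>u. u \<in> tang x \<and> tderiv H x u = w \<longrightarrow> norm v \<le> norm u)"
    by (simp add: A_def)
  from theI'[OF this] show "pinv_app H x w \<in> tang x" "tderiv H x (pinv_app H x w) = w"
    "\<And>u. u \<in> tang x \<Longrightarrow> tderiv H x u = w \<Longrightarrow> norm (pinv_app H x w) \<le> norm u"
    unfolding pinv_app_def by auto
qed

lemma Delta_in_vecs: "Delta H y \<in> vecs (length H)"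
  by (simp add: Delta_def vecs_def)

text \<open>A real \<open>Sup\<close> is sure to bound its members only if the set is bounded above.
  The bound \<open>B\<close> comes from an explicit combination of dual vectors, whose norm the
  minimal preimage cannot exceed.\<close>

lemma norm_pinv_app_Delta_le:
  fixes x :: "real^'n::finite"
  assumes surj: "deriv_surj H x" and "y \<in> vecs (length H)" "vnorm (length H) y \<le> 1"
  shows "norm (pinv_app H x (Delta H y)) \<le> pinv_delta_norm H x"
  unfolding pinv_delta_norm_def
proof (rule cSup_upper)
  obtain n where n: "\<And>i. i < length H \<Longrightarrow> n i \<in> tang x"
    "\<And>i j. i < length H \<Longrightarrow> j < length H \<Longrightarrow> Dpeval (H ! j) x (n i) = (if i = j then 1 else 0)"
    using deriv_surj_dual_vectors[OF surj] by blast
  define B where "B = (\<Sum>i<length H. sqrt (fst (H ! i)) * norm (n i))"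
  have "norm (pinv_app H x (Delta H y)) \<le> B"
    if y: "y \<in> vecs (length H)" "vnorm (length H) y \<le> 1" for y
  proof -
    define u where "u = (\<Sum>i<length H. Delta H y i *\<^sub>R n i)"
    have "u \<in> tang x" unfolding u_def using n(1)
      by (auto intro!: subspace_sum subspace_scale subspace_tang)
    moreover have "tderiv H x u = Delta H y"
    proof
      fix j
      show "tderiv H x u j = Delta H y j"
      proof (cases "j < length H")
        case True
        have "Dpeval (H ! j) x u = (\<Sum>i<length H. Delta H y i * Dpeval (H ! j) x (n i))"
          unfolding u_def by (simp add: linear_sum[OF linear_Dpeval] linear_scale[OF linear_Dpeval])
        also have "\<dots> = (\<Sum>i<length H. if i = j then Delta H y i else 0)"
          using n(2) True by (intro sum.cong) auto
        finally show ?thesis using True by (simp add: tderiv_def)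
      qed (simp add: tderiv_def Delta_def)
    qed
    ultimately have "norm (pinv_app H x (Delta H y)) \<le> norm u"
      by (rule norm_pinv_app_le[OF surj Delta_in_vecs])
    also have "\<dots> \<le> B"
      unfolding u_def B_def
    proof (rule sum_norm_le)
      fix i assume i: "i \<in> {..<length H}"
      have "(y i)\<^sup>2 \<le> (\<Sum>i<length H. (y i)\<^sup>2)" using i by (intro member_le_sum) auto
      also have "\<dots> \<le> 1" using y(2) by (simp add: vnorm_def)
      finally have "\<bar>y i\<bar> \<le> 1" by (simp add: abs_square_le_1)
      then have "\<bar>Delta H y i\<bar> \<le> sqrt (fst (H ! i))"
        using i by (simp add: Delta_def abs_mult mult_left_le)
      then show "norm (Delta H y i *\<^sub>R n i) \<le> sqrt (fst (H ! i)) * norm (n i)"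
        by (simp add: mult_right_mono)
    qed
    finally show ?thesis .
  qed
  then show "bdd_above {norm (pinv_app H x (Delta H y)) |y. y \<in> vecs (length H) \<and> vnorm (length H) y \<le> 1}"
    by (intro bdd_aboveI[of _ B]) blast
qed (use assms in blast)

section \<open>Condition numbers\<close>

lemma tnorm_nonneg: "0 \<le> tnorm H"
  unfolding tnorm_def by (intro real_sqrt_ge_zero sum_list_nonneg) auto

lemma tnorm_sq: "(tnorm H)\<^sup>2 = (\<Sum>i<length H. weyl_sq (H ! i))"
proof -
  have "0 \<le> (\<Sum>p\<leftarrow>H. weyl_sq p)" by (intro sum_list_nonneg) auto
  then show ?thesis
    unfolding tnorm_def by (simp add: sum_list_sum_nth atLeast0LessThan)
qed

lemma vnorm_teval_le_tnorm:
  assumes "norm x = 1"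
  shows "(vnorm (length H) (teval H x))\<^sup>2 \<le> (tnorm H)\<^sup>2"
proof -
  have "(vnorm (length H) (teval H x))\<^sup>2 = (\<Sum>i<length H. (peval (H ! i) x)\<^sup>2)"
    unfolding vnorm_def teval_def by (simp add: sum_nonneg)
  then show ?thesis unfolding tnorm_sq by (simp add: sum_mono peval_bound[OF assms])
qed

text \<open>Tests the first unit vector: its preimage \<open>v\<close> gives the first polynomial,
  of degree \<open>d\<close>, the derivative \<open>sqrt d\<close>, while
  \<open>Dpeval_bound\<close> allows at most \<open>sqrt d\<close> times its Weyl norm times
  \<open>norm v\<close>. As \<open>d \<ge> 1\<close>, the factor cancels.\<close>

lemma tnorm_pinv_delta_norm_ge_1:
  fixes x :: "real^'n::finite"
  assumes "H \<noteq> []" and deg: "\<And>p. p \<in> set H \<Longrightarrow> 1 \<le> fst p"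
    and x: "norm x = 1" and surj: "deriv_surj H x"
  shows "1 \<le> tnorm H * pinv_delta_norm H x"
proof -
  define y :: "nat \<Rightarrow> real" where "y i = (if i = 0 then 1 else 0)" for i
  define v where "v = pinv_app H x (Delta H y)"
  have len: "0 < length H" using assms(1) by simp
  have y: "y \<in> vecs (length H)" "vnorm (length H) y \<le> 1"
  proof -
    have "(\<Sum>i<length H. (y i)\<^sup>2) = (\<Sum>i<length H. if i = 0 then 1 else 0)"
      by (intro sum.cong) (auto simp: y_def)
    then show "vnorm (length H) y \<le> 1" by (simp add: vnorm_def)
  qed (use len in \<open>auto simp: y_def vecs_def\<close>)
  have v: "v \<in> tang x" "norm v \<le> pinv_delta_norm H x"
    unfolding v_def using pinv_app_in_tang[OF surj Delta_in_vecs] norm_pinv_app_Delta_le[OF surj y] by blast+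
  have "tderiv H x v = Delta H y" unfolding v_def by (rule tderiv_pinv_app[OF surj Delta_in_vecs])
  from fun_cong[OF this, of 0] have "Dpeval (H ! 0) x v = sqrt (fst (H ! 0))"
    using len by (simp add: tderiv_def Delta_def y_def)
  then have "real (fst (H ! 0)) \<le> weyl_sq (H ! 0) * (real (fst (H ! 0)) * (norm v)\<^sup>2)"
    using Dpeval_bound[OF x v(1), of "H ! 0"] by simp
  moreover have "real (fst (H ! 0)) > 0" using deg[of "H ! 0"] len by simp
  ultimately have "1 \<le> weyl_sq (H ! 0) * (norm v)\<^sup>2" by (simp add: mult.left_commute)
  also have "\<dots> \<le> (tnorm H)\<^sup>2 * (norm v)\<^sup>2"
    unfolding tnorm_sq using len by (intro mult_right_mono member_le_sum) auto
  finally have "1\<^sup>2 \<le> (tnorm H * norm v)\<^sup>2" by (simp add: power_mult_distrib)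
  then have "1 \<le> tnorm H * norm v" by (rule power2_le_imp_le) (simp add: tnorm_nonneg)
  also have "\<dots> \<le> tnorm H * pinv_delta_norm H x" using v tnorm_nonneg by (intro mult_left_mono)
  finally show ?thesis .
qed

lemma kappa_pt_zero_system:
  assumes "H \<noteq> []" "\<forall>p\<in>set H. \<forall>a. snd p a = 0"
  shows "kappa_pt H x = \<infinity>"
  unfolding kappa_pt_def by (rule if_P) (use assms in blast)

lemma kappa_pt_nonzero_system:
  assumes "\<not> (\<forall>p\<in>set H. \<forall>a. snd p a = 0)"
  shows "kappa_pt H x =
    (let m2 = (if mu_proj H x = \<infinity> then \<infinity> else ereal ((real_of_ereal (mu_proj H x))\<^sup>2));
         s = einv m2 + ereal ((vnorm (length H) (teval H x))\<^sup>2 / (tnorm H)\<^sup>2)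
     in einv (if s = \<infinity> then \<infinity> else ereal (sqrt (real_of_ereal s))))"
  unfolding kappa_pt_def Let_def by (rule if_not_P) (use assms in blast)

text \<open>Both summands under the root are at most 1: the first by
  \<open>tnorm_pinv_delta_norm_ge_1\<close>, or because it is 0 without surjectivity, the second by
  \<open>vnorm_teval_le_tnorm\<close>. A zero sum gives an infinite value.\<close>

lemma kappa_pt_ge:
  fixes x :: "real^'n::finite"
  assumes H: "H \<noteq> []" and deg: "\<And>p. p \<in> set H \<Longrightarrow> 1 \<le> fst p" and x: "norm x = 1"
  shows "ereal (1 / sqrt 2) \<le> kappa_pt H x"
proof (cases "\<forall>p\<in>set H. \<forall>a. snd p a = 0")
  case False
  define m2 where "m2 = (if mu_proj H x = \<infinity> then \<infinity> else ereal ((real_of_ereal (mu_proj H x))\<^sup>2))"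
  define q where "q = (vnorm (length H) (teval H x))\<^sup>2 / (tnorm H)\<^sup>2"
  have q: "0 \<le> q" "q \<le> 1" using vnorm_teval_le_tnorm[OF x, of H] by (auto simp: q_def divide_le_eq_1)
  obtain u where u: "einv m2 = ereal u" "0 \<le> u" "u \<le> 1"
  proof (cases "deriv_surj H x")
    case True
    define m where "m = tnorm H * pinv_delta_norm H x"
    have "1 \<le> m" unfolding m_def by (rule tnorm_pinv_delta_norm_ge_1[OF H deg x True])
    moreover have "m2 = ereal (m\<^sup>2)" using True by (simp add: m2_def m_def mu_proj_def)
    ultimately show ?thesis using that[of "1 / m\<^sup>2"] by (simp add: einv_def divide_le_eq_1 one_le_power)
  next
    case False
    then show ?thesis using that[of 0] by (simp add: m2_def mu_proj_def einv_def)
  qed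
  have "kappa_pt H x = einv (ereal (sqrt (u + q)))"
    unfolding kappa_pt_nonzero_system[OF False] Let_def m2_def[symmetric] q_def[symmetric] u(1) by simp
  moreover have "1 / sqrt 2 \<le> 1 / sqrt (u + q)" if "u + q \<noteq> 0"
  proof (rule divide_left_mono)
    show "sqrt (u + q) \<le> sqrt 2" using u q by simp
    show "0 < sqrt 2 * sqrt (u + q)" using that u q by simp
  qed simp
  ultimately show ?thesis by (simp add: einv_def)
qed (simp add: kappa_pt_zero_system[OF H])

text \<open>At a common zero the residual term vanishes, so \<open>kappa_pt\<close> reduces to
  \<open>mu_proj\<close>, infinite unless the derivative is surjective. The lower bound 1 keeps
  \<open>einv\<close> away from its value at 0.\<close>

lemma kappa_pt_at_zero:
  fixes x :: "real^'n::finite"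
  assumes H: "H \<noteq> []" and deg: "\<And>p. p \<in> set H \<Longrightarrow> 1 \<le> fst p" and x: "norm x = 1"
    and zero: "\<And>p. p \<in> set H \<Longrightarrow> peval p x = 0" and fin: "kappa_pt H x < \<infinity>"
  shows "deriv_surj H x" "kappa_pt H x = ereal (tnorm H * pinv_delta_norm H x)"
proof -
  have nz: "\<not> (\<forall>p\<in>set H. \<forall>a. snd p a = 0)"
    using fin kappa_pt_zero_system[OF H] by (metis less_irrefl)
  have z: "vnorm (length H) (teval H x) = 0" using zero by (simp add: vnorm_def teval_def)
  show surj: "deriv_surj H x"
  proof (rule ccontr)
    assume "\<not> deriv_surj H x"
    then have "kappa_pt H x = \<infinity>" using z by (simp add: kappa_pt_nonzero_system[OF nz] mu_proj_def einv_def)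
    then show False using fin by simp
  qed
  define m where "m = tnorm H * pinv_delta_norm H x"
  have "1 \<le> m" unfolding m_def by (rule tnorm_pinv_delta_norm_ge_1[OF H deg x surj])
  moreover have "mu_proj H x = ereal m" using surj by (simp add: m_def mu_proj_def)
  ultimately have "kappa_pt H x = ereal m"
    using z by (simp add: kappa_pt_nonzero_system[OF nz] einv_def real_sqrt_divide)
  then show "kappa_pt H x = ereal (tnorm H * pinv_delta_norm H x)" by (simp add: m_def)
qed

text \<open>\<open>w\<close> is the minimal-norm preimage of the vector of Taylor remainders. Of the
  degree factor in each remainder, \<open>Delta\<close> absorbs one square root; the other is at
  most \<open>sqrt D\<close>.\<close>

lemma tangential_correction:
  fixes a b :: "real^'n::finite"
  assumes surj: "deriv_surj H a" and a: "norm a = 1" and b: "norm b = 1"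
    and zero: "\<And>p. p \<in> set H \<Longrightarrow> peval p a = 0"
    and deg: "\<And>p. p \<in> set H \<Longrightarrow> 1 \<le> fst p \<and> fst p \<le> D"
  obtains w where "w \<in> tang a"
    and "\<And>i. i < length H \<Longrightarrow> Dpeval (H ! i) a w = peval (H ! i) b - Dpeval (H ! i) a (b - (a \<bullet> b) *\<^sub>R a)"
    and "norm w \<le> sqrt D * (tnorm H * pinv_delta_norm H a) * (norm (b - a))\<^sup>2"
proof -
  define R where "R i = peval (H ! i) b - Dpeval (H ! i) a (b - (a \<bullet> b) *\<^sub>R a)" for i
  \<comment> \<open>\<open>\<rho>\<close> bounds the Euclidean norm of the remainders divided by the
    roots of their degrees, so that \<open>y\<close> falls into the unit ball used in
    \<open>pinv_delta_norm\<close>.\<close>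
  define \<rho> where "\<rho> = sqrt D * tnorm H * (norm (b - a))\<^sup>2"
  have \<rho>0: "\<rho> \<ge> 0" by (simp add: \<rho>_def tnorm_nonneg)
  define y where "y i = (if i < length H then R i / (sqrt (fst (H ! i)) * \<rho>) else 0)" for i
  have R: "(R i)\<^sup>2 / real (fst (H ! i)) \<le> real D * norm (b - a) ^ 4 * weyl_sq (H ! i)"
    if i: "i < length H" for i
  proof -
    have d: "1 \<le> fst (H ! i)" "fst (H ! i) \<le> D" "peval (H ! i) a = 0" using deg zero i by auto
    have "(R i)\<^sup>2 \<le> weyl_sq (H ! i) * ((real (fst (H ! i)))\<^sup>2 * norm (b - a) ^ 4)"
      unfolding R_def by (rule peval_taylor_bound[OF a b d(3)])
    then have "(R i)\<^sup>2 / real (fst (H ! i)) \<le> real (fst (H ! i)) * (norm (b - a) ^ 4 * weyl_sq (H ! i))"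
      using d(1) by (simp add: divide_le_eq power2_eq_square mult_ac)
    also have "\<dots> \<le> real D * (norm (b - a) ^ 4 * weyl_sq (H ! i))"
      using d(2) by (intro mult_right_mono) auto
    finally show ?thesis by (simp add: mult.assoc)
  qed
  have "(\<Sum>i<length H. (R i)\<^sup>2 / real (fst (H ! i))) \<le> (\<Sum>i<length H. real D * norm (b - a) ^ 4 * weyl_sq (H ! i))"
    using R by (intro sum_mono) auto
  also have "\<dots> = \<rho>\<^sup>2"
    by (simp add: sum_distrib_left[symmetric] tnorm_sq[symmetric] \<rho>_def power_mult_distrib power_mult[symmetric])
  finally have sum_R: "(\<Sum>i<length H. (R i)\<^sup>2 / real (fst (H ! i))) \<le> \<rho>\<^sup>2" .
  have y: "y \<in> vecs (length H)" by (simp add: y_def vecs_def)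
  have "(\<Sum>i<length H. (y i)\<^sup>2) = (\<Sum>i<length H. (R i)\<^sup>2 / real (fst (H ! i))) / \<rho>\<^sup>2"
    by (simp add: y_def power_divide power_mult_distrib sum_divide_distrib)
  also have "\<dots> \<le> 1" using sum_R by (simp add: divide_le_eq_1)
  finally have vy: "vnorm (length H) y \<le> 1" by (simp add: vnorm_def)
  define w where "w = \<rho> *\<^sub>R pinv_app H a (Delta H y)"
  show thesis
  proof (rule that[of w])
    show "w \<in> tang a"
      unfolding w_def by (intro subspace_scale subspace_tang pinv_app_in_tang[OF surj Delta_in_vecs])
    have "norm w \<le> \<rho> * pinv_delta_norm H a"
      unfolding w_def using norm_pinv_app_Delta_le[OF surj y vy] \<rho>0 by (simp add: mult_left_mono)
    then show "norm w \<le> sqrt D * (tnorm H * pinv_delta_norm H a) * (norm (b - a))\<^sup>2"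
      by (simp add: \<rho>_def mult_ac)
    fix i assume i: "i < length H"
    have d: "sqrt (fst (H ! i)) > 0" using deg[of "H ! i"] i by simp
    have "Dpeval (H ! i) a w = \<rho> * Delta H y i"
      using fun_cong[OF tderiv_pinv_app[OF surj Delta_in_vecs[of H y]], of i] i
      unfolding w_def by (simp add: tderiv_def linear_scale[OF linear_Dpeval])
    also have "\<dots> = R i"
    proof (cases "\<rho> = 0")
      \<comment> \<open>Division by zero makes \<open>y\<close> vanish here, but the bound on the
        sum then forces \<open>R i = 0\<close>.\<close>
      case True
      have "(R i)\<^sup>2 / real (fst (H ! i)) \<le> (\<Sum>i<length H. (R i)\<^sup>2 / real (fst (H ! i)))"
        using i by (intro member_le_sum) auto
      then have "(R i)\<^sup>2 / real (fst (H ! i)) \<le> 0" using sum_R True by simp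
      then show ?thesis using d True by (simp add: divide_le_0_iff)
    qed (use i d in \<open>simp add: Delta_def y_def\<close>)
    finally show "Dpeval (H ! i) a w = peval (H ! i) b - Dpeval (H ! i) a (b - (a \<bullet> b) *\<^sub>R a)"
      by (simp add: R_def)
  qed
qed

section \<open>Bottlenecks and the reach\<close>

text \<open>The nearby points satisfy \<open>peval p x = t * Dpeval p a v\<close> exactly for
  \<open>p\<close> in \<open>H\<close>: equations stay zero, active inequalities stay nonnegative,
  and inactive ones stay positive near \<open>a\<close>.\<close>

lemma feasible_direction_curve:
  fixes a v :: "real^'n::finite"
  assumes a: "a \<in> SFG F G" and surj: "deriv_surj H a"
    and H: "set F \<subseteq> set H"
    and active: "\<And>g. g \<in> set G \<Longrightarrow> peval g a = 0 \<Longrightarrow> g \<in> set H"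
    and zero: "\<And>p. p \<in> set H \<Longrightarrow> peval p a = 0"
    and v: "v \<in> tang a"
    and vF: "\<And>p. p \<in> set F \<Longrightarrow> Dpeval p a v = 0"
    and vG: "\<And>p. p \<in> set H \<Longrightarrow> p \<in> set G \<Longrightarrow> 0 \<le> Dpeval p a v"
    and e: "e > 0"
  shows "\<exists>d>0. \<forall>t. 0 < t \<and> t < d \<longrightarrow> (\<exists>x\<in>SFG F G. norm (x - a - t *\<^sub>R v) \<le> e * t)"
proof -
  have aa: "a \<bullet> a = 1" using a by (simp add: SFG_def dot_square_norm)
  obtain n where n: "\<And>i. i < length H \<Longrightarrow> n i \<in> tang a"
    "\<And>i j. i < length H \<Longrightarrow> j < length H \<Longrightarrow> Dpeval (H ! j) a (n i) = (if i = j then 1 else 0)"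
    using deriv_surj_dual_vectors[OF surj] by blast
  \<comment> \<open>Index \<open>k\<close> stands for the equation of the unit sphere, whose dual vector is \<open>a\<close> itself because the
    derivatives of the active polynomials vanish in the radial direction.\<close>
  define k where "k = length H"
  define \<phi> where "\<phi> i = (if i < k then peval (H ! i) else (\<lambda>x. (x \<bullet> x - 1) / 2))" for i
  define \<phi>' where "\<phi>' i = (if i < k then Dpeval (H ! i) a else (\<lambda>h. a \<bullet> h))" for i
  define n' where "n' i = (if i < k then n i else a)" for i
  have "\<exists>d>0. \<forall>t. 0 < t \<and> t < d \<longrightarrow>
      (\<exists>x. norm (x - a - t *\<^sub>R v) \<le> e * t \<and> (\<forall>i\<in>{..k}. \<phi> i x = t * \<phi>' i v))"
  proof (rule approx_curve_in_constraints[where n=n'])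
    fix i assume "i \<in> {..k}"
    show "continuous_on UNIV (\<phi> i)"
      by (auto simp: \<phi>_def continuous_on_peval intro!: continuous_intros)
    have "((\<lambda>x. (x \<bullet> x - 1) / 2) has_derivative (\<lambda>h. a \<bullet> h)) (at a)"
      by (auto intro!: derivative_eq_intros simp: inner_commute)
    then show "(\<phi> i has_derivative \<phi>' i) (at a)" by (simp add: \<phi>_def \<phi>'_def Dpeval_works)
    show "\<phi> i a = 0" using aa zero by (simp add: \<phi>_def k_def)
    fix j assume "j \<in> {..k}"
    then show "\<phi>' j (n' i) = (if i = j then 1 else 0)"
      using \<open>i \<in> {..k}\<close> n aa zero
      by (auto simp: \<phi>'_def n'_def k_def tang_def inner_commute Dpeval_radial_zero)
  qed (use e in auto)
  then obtain d1 where d1: "d1 > 0" "\<And>t. 0 < t \<Longrightarrow> t < d1 \<Longrightarrow>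
      \<exists>x. norm (x - a - t *\<^sub>R v) \<le> e * t \<and> (\<forall>i\<in>{..k}. \<phi> i x = t * \<phi>' i v)"
    by blast
  define U where "U = (\<Inter>g\<in>{g \<in> set G. peval g a \<noteq> 0}. {x. 0 < peval g x})"
  have "open U"
    unfolding U_def by (intro open_INT ballI open_Collect_less continuous_on_peval continuous_on_const) auto
  moreover have "a \<in> U" using a by (force simp: U_def SFG_def)
  ultimately obtain \<eta> where \<eta>: "\<eta> > 0" "ball a \<eta> \<subseteq> U" using open_contains_ball by blast
  have nve: "norm v + e > 0" using e by (simp add: add_nonneg_pos)
  show ?thesis
  proof (rule exI[of _ "min d1 (\<eta> / (norm v + e))"], intro conjI allI impI)
    show "0 < min d1 (\<eta> / (norm v + e))" using d1 \<eta> nve by simp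
    fix t assume t: "0 < t \<and> t < min d1 (\<eta> / (norm v + e))"
    then obtain x where x: "norm (x - a - t *\<^sub>R v) \<le> e * t" "\<And>i. i \<le> k \<Longrightarrow> \<phi> i x = t * \<phi>' i v"
      using d1(2)[of t] by auto
    have "norm (x - a) \<le> norm (x - a - t *\<^sub>R v) + norm (t *\<^sub>R v)"
      using norm_triangle_ineq[of "x - a - t *\<^sub>R v" "t *\<^sub>R v"] by simp
    also have "\<dots> \<le> t * (norm v + e)" using x(1) t by (simp add: algebra_simps)
    also have "\<dots> < \<eta>" using t nve by (simp add: pos_less_divide_eq)
    finally have xU: "x \<in> U" using \<eta> by (auto simp: dist_norm norm_minus_commute)
    have pH: "peval p x = t * Dpeval p a v" if p: "p \<in> set H" for p
    proof -
      obtain i where "i < length H" "H ! i = p" using p unfolding in_set_conv_nth by blast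
      then show ?thesis using x(2)[of i] by (simp add: \<phi>_def \<phi>'_def k_def)
    qed
    have "\<phi> k x = t * \<phi>' k v" using x(2) by blast
    then have "x \<bullet> x = 1" using v by (simp add: \<phi>_def \<phi>'_def tang_def inner_commute)
    then have "norm x = 1" by (simp add: norm_eq_1)
    moreover have "peval p x = 0" if "p \<in> set F" for p
      using pH[OF subsetD[OF H that]] vF[OF that] by simp
    moreover have "0 \<le> peval p x" if "p \<in> set G" for p
    proof (cases "peval p a = 0")
      case True
      with that have "p \<in> set H" by (rule active)
      then show ?thesis using pH vG that t by simp
    next
      case False
      then have "0 < peval p x" using xU that unfolding U_def by blast
      then show ?thesis by simp
    qed
    ultimately show "\<exists>x\<in>SFG F G. norm (x - a - t *\<^sub>R v) \<le> e * t"
      using x(1) by (intro bexI[of _ x]) (auto simp: SFG_def)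
  qed
qed

text \<open>With exactly the inequalities active at \<open>a\<close> appended, the whole system
  vanishes there, so the bound on \<open>kappa_star\<close> controls its pseudoinverse. It remains
  to see that this subsystem is small enough to be admissible.\<close>

lemma active_subsystem:
  fixes F G :: "('n::finite) hpoly list"
  assumes deg: "\<And>p. p \<in> set (F @ G) \<Longrightarrow> 1 \<le> fst p"
    and q_le: "length F \<le> CARD('n)" and K: "kappa_star F G \<le> ereal K" "0 \<le> K"
    and a: "a \<in> SFG F G"
  obtains H where "set F \<subseteq> set H" "set H \<subseteq> set F \<union> set G"
    and "\<And>g. g \<in> set G \<Longrightarrow> peval g a = 0 \<Longrightarrow> g \<in> set H"
    and "\<And>p. p \<in> set H \<Longrightarrow> peval p a = 0"
    and "deriv_surj H a" "tnorm H * pinv_delta_norm H a \<le> K"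
proof -
  have na: "norm a = 1" using a by (simp add: SFG_def)
  define I where "I = {j. j < length G \<and> peval (G ! j) a = 0}"
  have I: "I \<subseteq> {..<length G}" "finite I" by (auto simp: I_def)
  have sub: "deriv_surj (F @ nths G J) a \<and>
      tnorm (F @ nths G J) * pinv_delta_norm (F @ nths G J) a \<le> K"
    if J: "J \<subseteq> I" "length F + card J \<le> CARD('n)" for J
  proof (cases "F @ nths G J = []")
    \<comment> \<open>The empty system is outside \<open>kappa_pt_at_zero\<close>; its derivative is
      trivially onto and its \<open>tnorm\<close> is 0, so \<open>0 \<le> K\<close>
      suffices.\<close>
    case True
    then show ?thesis using K(2) by (simp add: deriv_surj_def tderiv_def vecs_def tnorm_def tang_def)
       (auto intro: exI[of _ 0])
  next
    case False
    have "kappa_pt (F @ nths G J) a \<le> kappa (F @ nths G J)"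
      unfolding kappa_def using na by (intro SUP_upper) auto
    also have "\<dots> \<le> kappa_star F G"
      unfolding kappa_star_def using J I by (intro SUP_upper) auto
    finally have le: "kappa_pt (F @ nths G J) a \<le> ereal K" using K(1) by (rule order_trans)
    have "\<And>p. p \<in> set (F @ nths G J) \<Longrightarrow> 1 \<le> fst p"
      using deg set_nths_subset[of G J] by auto
    moreover have "\<And>p. p \<in> set (F @ nths G J) \<Longrightarrow> peval p a = 0"
      using a J(1) by (auto simp: SFG_def set_nths I_def)
    moreover have "kappa_pt (F @ nths G J) a < \<infinity>" using le by (rule le_less_trans) simp
    ultimately show ?thesis using kappa_pt_at_zero[OF False _ na] le by fastforce
  qed
  \<comment> \<open>Otherwise \<open>CARD('n)\<close> active polynomials would have a surjective derivative on the tangent space,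
    whose dimension is only \<open>CARD('n) - 1\<close>.\<close>
  have "length F + card I \<le> CARD('n)"
  proof (rule ccontr)
    assume "\<not> ?thesis"
    then have "CARD('n) - length F \<le> card I" by simp
    then obtain J where J: "J \<subseteq> I" "card J = CARD('n) - length F"
      using obtain_subset_with_card_n by metis
    have "{i. i < length G \<and> i \<in> J} = J" using J(1) I by auto
    then have "length (F @ nths G J) = CARD('n)" using J(2) q_le by (simp add: length_nths)
    moreover have "deriv_surj (F @ nths G J) a" using sub J q_le by auto
    ultimately show False using deriv_surj_length_less[of "F @ nths G J" a] na by force
  qed
  then have "deriv_surj (F @ nths G I) a" "tnorm (F @ nths G I) * pinv_delta_norm (F @ nths G I) a \<le> K"
    using sub by auto
  moreover have "g \<in> set (F @ nths G I)" if "g \<in> set G" "peval g a = 0" for g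
    using that by (auto simp: set_nths I_def in_set_conv_nth)
  moreover have "peval p a = 0" if "p \<in> set (F @ nths G I)" for p
    using that a by (auto simp: SFG_def set_nths I_def)
  ultimately show thesis
    using set_nths_subset[of G I] by (intro that[of "F @ nths G I"]) auto
qed

text \<open>The gain along \<open>u\<close> and the cost of \<open>w\<close> are both of order
  \<open>(norm (b - a))\<^sup>2\<close>, so this factor cancels and the bound is independent of how
  close \<open>a\<close> and \<open>b\<close> are.\<close>

lemma bottleneck_radius:
  fixes F G :: "('n::finite) hpoly list"
  assumes deg: "\<And>p. p \<in> set (F @ G) \<Longrightarrow> 1 \<le> fst p \<and> fst p \<le> D"
    and q_le: "length F \<le> CARD('n)" and K: "kappa_star F G \<le> ereal K" "0 \<le> K"
    and a: "a \<in> SFG F G" and b: "b \<in> SFG F G" and ne: "a \<noteq> b"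
    and near: "\<And>x. x \<in> SFG F G \<Longrightarrow> norm (z - a) \<le> norm (z - x)"
    and eq: "norm (z - b) = norm (z - a)"
  shows "1 \<le> norm (z - a) * (1 + 2 * sqrt D * K)"
proof -
  obtain H where H: "set F \<subseteq> set H" "set H \<subseteq> set F \<union> set G"
    "\<And>g. g \<in> set G \<Longrightarrow> peval g a = 0 \<Longrightarrow> g \<in> set H" "\<And>p. p \<in> set H \<Longrightarrow> peval p a = 0"
    "deriv_surj H a" "tnorm H * pinv_delta_norm H a \<le> K"
    using active_subsystem[OF _ q_le K a] deg by blast
  have na: "norm a = 1" and nb: "norm b = 1" using a b by (simp_all add: SFG_def)
  have aa: "a \<bullet> a = 1" "b \<bullet> b = 1" using na nb by (simp_all add: dot_square_norm)
  define u where "u = b - (a \<bullet> b) *\<^sub>R a"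
  define r where "r = norm (z - a)"
  define \<delta> where "\<delta> = (norm (b - a))\<^sup>2"
  have \<delta>: "\<delta> > 0" using ne by (simp add: \<delta>_def)
  obtain w where w: "w \<in> tang a"
    "\<And>i. i < length H \<Longrightarrow> Dpeval (H ! i) a w = peval (H ! i) b - Dpeval (H ! i) a u"
    "norm w \<le> sqrt D * (tnorm H * pinv_delta_norm H a) * \<delta>"
    unfolding u_def \<delta>_def
    by (rule tangential_correction[OF H(5) na nb H(4), of D]) (use deg H(2) in auto)
  \<comment> \<open>The derivatives along \<open>u + w\<close> are the values at \<open>b\<close>:
    zero on \<open>F\<close> and nonnegative on \<open>G\<close>, which is feasibility at
    \<open>a\<close>.\<close>
  have Duw: "Dpeval p a (u + w) = peval p b" if "p \<in> set H" for p
    using w(2) that by (auto simp: in_set_conv_nth linear_add[OF linear_Dpeval])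
  have "u \<in> tang a" using aa by (simp add: u_def tang_def inner_diff inner_commute)
  then have "u + w \<in> tang a" using w(1) subspace_add subspace_tang by blast
  have "(z - a) \<bullet> (u + w) \<le> 0"
  proof (rule nearest_point_first_order[OF near])
    fix e :: real assume "e > 0"
    show "\<exists>d>0. \<forall>t. 0 < t \<and> t < d \<longrightarrow> (\<exists>x\<in>SFG F G. norm (x - a - t *\<^sub>R (u + w)) \<le> e * t)"
      by (rule feasible_direction_curve[OF a H(5) H(1) H(3) H(4)])
         (use \<open>u + w \<in> tang a\<close> \<open>e > 0\<close> Duw H(1) b in \<open>auto simp: SFG_def\<close>)
  qed auto
  moreover have "(z - a) \<bullet> u \<ge> \<delta> / 2 - \<delta> / 2 * r"
  proof -
    have "(z - a - (b - a)) \<bullet> (z - a - (b - a)) = (z - a) \<bullet> (z - a)"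
      using eq by (simp add: norm_eq)
    then have 1: "2 * ((z - a) \<bullet> (b - a)) = \<delta>"
      unfolding \<delta>_def power2_norm_eq_inner inner_diff_left[of "z - a"] inner_diff_right[of _ "z - a"]
        inner_commute[of "b - a" "z - a"] by simp
    have "\<delta> = 2 - 2 * (a \<bullet> b)"
      using aa by (simp add: \<delta>_def power2_norm_eq_inner inner_diff inner_commute)
    \<comment> \<open>Hence \<open>u\<close> is the chord \<open>b - a\<close> plus
      \<open>\<delta> / 2\<close> times \<open>a\<close>. Equidistance gives the chord the product
      \<open>\<delta> / 2\<close>, and Cauchy-Schwarz limits the radial loss to
      \<open>\<delta> / 2 * r\<close>.\<close>
    then have half: "\<delta> / 2 = 1 - a \<bullet> b" by simp
    have "u = (b - a) + (\<delta> / 2) *\<^sub>R a" unfolding half u_def by (simp add: scaleR_left_diff_distrib)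
    then have "(z - a) \<bullet> u = \<delta> / 2 + \<delta> / 2 * ((z - a) \<bullet> a)"
      using 1 by (simp only: inner_add_right inner_scaleR_right)
    moreover have "- r \<le> (z - a) \<bullet> a"
      using Cauchy_Schwarz_ineq2[of "z - a" a] na unfolding r_def by simp
    ultimately show ?thesis using \<delta> mult_left_mono[of "- r" "(z - a) \<bullet> a" "\<delta> / 2"] by simp
  qed
  moreover have "- (r * (sqrt D * K * \<delta>)) \<le> (z - a) \<bullet> w"
  proof -
    have "norm w \<le> sqrt D * K * \<delta>"
      using w(3) H(6) \<delta> by (meson mult_left_mono mult_right_mono order_trans less_imp_le real_sqrt_ge_zero of_nat_0_le_iff)
    then have "r * norm w \<le> r * (sqrt D * K * \<delta>)" unfolding r_def by (intro mult_left_mono) auto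
    moreover have "- (r * norm w) \<le> (z - a) \<bullet> w"
      using Cauchy_Schwarz_ineq2[of "z - a" w] unfolding r_def by simp
    ultimately show ?thesis by simp
  qed
  ultimately have "\<delta> / 2 - \<delta> / 2 * r - r * (sqrt D * K * \<delta>) \<le> 0"
    unfolding inner_add_right by simp
  then have "\<delta> * 1 \<le> \<delta> * (r * (1 + 2 * sqrt D * K))" by (simp add: algebra_simps)
  then show ?thesis using \<delta> unfolding r_def by simp
qed

theorem theorem4p12:
  fixes F G :: "('n::finite) hpoly list"
  assumes wf: "\<forall>p\<in>set (F @ G). hpoly_wf p \<and> fst p \<ge> 1"
    and nonempty: "F @ G \<noteq> []"
    and q_le: "length F \<le> CARD('n)"
    and fin: "kappa_star F G < \<infinity>"
  shows "ereal (real (Max (fst ` set (F @ G))) powr (3/2)) * reach (SFG F G) * kappa_star F G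
           \<ge> ereal (1/7)"
proof -
  define D where "D = Max (fst ` set (F @ G))"
  have deg: "1 \<le> fst p \<and> fst p \<le> D" if "p \<in> set (F @ G)" for p
    using that wf by (auto simp: D_def intro!: Max_ge)
  have D: "1 \<le> D" using deg[of "hd (F @ G)"] nonempty hd_in_set[of "F @ G"] by (meson order_trans)
  have K_ge: "ereal (1 / sqrt 2) \<le> kappa_star F G"
  proof -
    \<comment> \<open>\<open>kappa_pt_ge\<close> asks for a nonempty system. Without equations a
      single inequality is taken, admissible because \<open>CARD('n)\<close> is at least 1.\<close>
    obtain I where I: "I \<subseteq> {..<length G}" "length F + card I \<le> CARD('n)" "F @ nths G I \<noteq> []"
    proof (cases "F = []")
      case True
      then have "nths G {0} \<noteq> []" using nonempty by (cases G) (auto simp: nths_Cons)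
      moreover have "1 \<le> CARD('n)" using zero_less_card_finite[where 'a='n] by linarith
      ultimately show ?thesis using True nonempty by (intro that[of "{0}"]) auto
    next
      case False
      then show ?thesis using q_le by (intro that[of "{}"]) auto
    qed
    define x :: "real^'n" where "x = axis undefined 1"
    have x: "norm x = 1" by (simp add: x_def norm_axis_1)
    have "ereal (1 / sqrt 2) \<le> kappa_pt (F @ nths G I) x"
      using deg set_nths_subset[of G I] by (intro kappa_pt_ge[OF I(3) _ x]) auto
    also have "\<dots> \<le> kappa (F @ nths G I)" unfolding kappa_def using x by (intro SUP_upper) auto
    also have "\<dots> \<le> kappa_star F G" unfolding kappa_star_def using I by (intro SUP_upper) auto
    finally show ?thesis .
  qed
  then obtain K where K: "kappa_star F G = ereal K" using fin by (cases "kappa_star F G") auto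
  have K2: "1 / sqrt 2 \<le> K" using K_ge K by simp
  then have K0: "K > 0" by (rule less_le_trans[rotated]) simp
  define E where "E = real D powr (3/2)"
  have E: "sqrt D \<le> E" "E \<ge> 1" using D by (auto simp: E_def powr_half_sqrt[symmetric] intro!: powr_mono ge_one_powr_ge_zero)
  \<comment> \<open>The lower bound on \<open>K\<close> gives \<open>1 \<le> 2 * (E * K)\<close>;
    with \<open>sqrt D \<le> E\<close> the left side is at most \<open>4 * (E * K)\<close>.\<close>
  have "1 + 2 * sqrt D * K \<le> 7 * E * K"
  proof -
    have "1 = sqrt 2 * (1 / sqrt 2)" by simp
    also have "\<dots> \<le> 2 * K" using K2 sqrt2_less_2 by (intro mult_mono) auto
    also have "\<dots> \<le> 2 * (E * K)" using E K0 by simp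
    finally have "1 \<le> 2 * (E * K)" .
    moreover have "sqrt D * K \<le> E * K" using E K0 by (intro mult_right_mono) auto
    moreover have "0 \<le> E * K" using E K0 by simp
    ultimately show ?thesis by linarith
  qed
  then have rad: "1 / (7 * E * K) \<le> r" if "1 \<le> r * (1 + 2 * sqrt D * K)" "0 \<le> r" for r
  proof -
    have "1 \<le> r * (7 * E * K)" using that \<open>1 + 2 * sqrt D * K \<le> 7 * E * K\<close> by (meson mult_left_mono order_trans)
    moreover have "0 < 7 * E * K" using E K0 by simp
    ultimately show ?thesis by (simp add: divide_le_eq)
  qed
  have dist_ge: "1 / (7 * E * K) \<le> dist p z"
    if p: "p \<in> SFG F G" and z: "z \<in> medial (SFG F G)" for p z
  proof -
    \<comment> \<open>\<open>medial\<close> is a closure and the distance bound a closed condition,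
      so it suffices to treat points with two nearest points.\<close>
    have "{x. \<exists>a b. a \<in> SFG F G \<and> b \<in> SFG F G \<and> a \<noteq> b \<and> ereal (dist x a) = dset (SFG F G) x \<and>
        ereal (dist x b) = dset (SFG F G) x} \<subseteq> {x. 1 / (7 * E * K) \<le> dist p x}"
    proof clarify
      fix x a b assume ab: "a \<in> SFG F G" "b \<in> SFG F G" "a \<noteq> b"
        and d: "ereal (dist x a) = dset (SFG F G) x" "ereal (dist x b) = dset (SFG F G) x"
      have near: "norm (x - a) \<le> norm (x - y)" if "y \<in> SFG F G" for y
      proof -
        have "dset (SFG F G) x \<le> ereal (dist x y)" unfolding dset_def using that by (rule INF_lower)
        then show ?thesis by (simp add: d(1)[symmetric] dist_norm)
      qed
      have "norm (x - b) = norm (x - a)" using d by (metis dist_norm ereal.inject)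
      then have "1 \<le> norm (x - a) * (1 + 2 * sqrt D * K)"
        using bottleneck_radius[OF deg q_le _ _ ab near] K K0 by simp
      then have "1 / (7 * E * K) \<le> norm (x - a)" by (rule rad) simp
      also have "\<dots> \<le> dist p x" using near[OF p] by (simp add: dist_norm norm_minus_commute)
      finally show "1 / (7 * E * K) \<le> dist p x" .
    qed
    moreover have "closed {x. 1 / (7 * E * K) \<le> dist p x}"
      by (intro closed_Collect_le continuous_intros)
    ultimately show ?thesis using z closure_minimal unfolding medial_def by blast
  qed
  \<comment> \<open>Infima over an empty set or an empty medial axis are infinite, so the bound
    holds there too.\<close>
  have reach: "ereal (1 / (7 * E * K)) \<le> reach (SFG F G)"
    unfolding reach_def dset_def using dist_ge by (intro INF_greatest) auto
  have "ereal (1/7) = ereal E * ereal (1 / (7 * E * K)) * ereal K" using E K0 by simp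
  also have "\<dots> \<le> ereal E * reach (SFG F G) * ereal K"
    using reach E K0 by (intro ereal_mult_right_mono ereal_mult_left_mono) auto
  finally show ?thesis by (simp add: K E_def D_def)
qed

end
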